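(* Let $\lambda_1,\lambda_2\ge 0$, $c\in\mathbb{R}$, and let $\alpha_1,\alpha_2\ge 2$ be even integers. Let $$p(x_1,x_2)=\lambda_1\lambda_2\big(x_1^{2\alpha_1}+x_2^{2\alpha_2}\big)+(\lambda_1^2+\lambda_2^2-c)\,x_1^{\alpha_1}x_2^{\alpha_2}.$$ If $p$ is convex on $\mathbb{R}^2$, then $p$ is SOS-convex.
   Context: A polynomial $p$ in $n$ variables with Hessian matrix $H(x)$ is SOS-convex if $H$ is an SOS-matrix, i.e. $H(x)=L(x)^TL(x)$ for some polynomial matrix $L(x)$; equivalently, the polynomial $z^TH(x)z$ in the variables $(x,z)$ is a sum of squares of polynomials. *)

theory Defs
  imports "HOL-Analysis.Analysis" "HOL-Computational_Algebra.Polynomial" "Jordan_Normal_Form.Matrix"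
begin

text \<open>Polynomials in \<open>x\<^sub>1, x\<^sub>2\<close> are elements of \<open>\<real>[x\<^sub>1][x\<^sub>2]\<close>: the outer
  polynomial variable is \<open>x\<^sub>2\<close>, its coefficients are polynomials in \<open>x\<^sub>1\<close>.\<close>

type_synonym bipoly = "real poly poly"

definition Const :: "real \<Rightarrow> bipoly" where
  "Const r = [:[:r:]:]"

definition X1 :: bipoly where
  "X1 = [:[:0, 1:]:]"

definition X2 :: bipoly where
  "X2 = [:0, 1:]"

definition eval :: "bipoly \<Rightarrow> real \<times> real \<Rightarrow> real" where
  "eval p x = poly (poly p [:snd x:]) (fst x)"

text \<open>Index \<open>0\<close> stands for \<open>x\<^sub>1\<close> and any other index for \<open>x\<^sub>2\<close>, in agreement with the
  zero-based indexing of matrices.\<close>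

definition partial :: "nat \<Rightarrow> bipoly \<Rightarrow> bipoly" where
  "partial i p = (if i = 0 then map_poly pderiv p else pderiv p)"

definition hessian :: "bipoly \<Rightarrow> bipoly mat" where
  "hessian p = mat 2 2 (\<lambda>(i, j). partial i (partial j p))"

text \<open>The factor \<open>L\<close> need not be square: its number of rows \<open>m\<close> is the number of
  squares and is unrestricted.\<close>

definition sos_matrix :: "bipoly mat \<Rightarrow> bool" where
  "sos_matrix H \<longleftrightarrow> (\<exists>m. \<exists>L \<in> carrier_mat m (dim_col H). H = transpose_mat L * L)"

definition sos_convex :: "bipoly \<Rightarrow> bool" where
  "sos_convex p \<longleftrightarrow> sos_matrix (hessian p)"

end

theory Submission
  imports Defs
begin

text \<open>
  Put \<open>A = \<lambda>\<^sub>1 \<lambda>\<^sub>2 \<ge> 0\<close> and \<open>B = \<lambda>\<^sub>1\<^sup>2 + \<lambda>\<^sub>2\<^sup>2 - c\<close>, so that the polynomial is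
  \<open>A (x^(2a) + y^(2b)) + B x^a y^b\<close>; only the signs of \<open>A\<close> and \<open>B\<close> and one inequality between
  them matter. The form \<open>z\<^sup>T H z\<close> of its Hessian involves five monomials,
  and the mixed one, \<open>2 a b B x^(a-1) y^(b-1) z\<^sub>1 z\<^sub>2\<close>, can be produced by two different products:
  by \<open>x^(a-1) z\<^sub>1\<close> times \<open>y^(b-1) z\<^sub>2\<close>, and by \<open>x^(a/2-1) y^(b/2) z\<^sub>1\<close> times
  \<open>x^(a/2) y^(b/2-1) z\<^sub>2\<close>. The squares of these four expressions are the four diagonal monomials.
  So \<open>z\<^sup>T H z\<close> is a sum of squares as soon as the coefficient \<open>a b B\<close> can be split between two
  binary quadratic forms without making either indefinite. With \<open>B \<ge> 0\<close> this is possible iff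
  \<open>a b B\<close> is at most the sum of the two geometric means of the diagonal coefficients, which after
  division by \<open>sqrt (a b)\<close> reads

  \<open>B sqrt (a b) \<le> 2 A sqrt ((2a-1) (2b-1)) + B sqrt ((a-1) (b-1))\<close>.

  Convexity implies exactly this inequality. Along the line
  \<open>t \<mapsto> (x (1 + t k), y (1 + t l))\<close> the exponents turn into polynomial factors of
  the second derivative at \<open>0\<close>, which depends on the point only through
  \<open>u = x^a\<close> and \<open>v = y^b\<close> (lemma \<open>second_deriv_along_scaling_line\<close>). Letting \<open>v\<close> grow gives
  \<open>B \<ge> 0\<close> (lemma \<open>coeff_nonneg_if_convex\<close>). Choosing the point and the direction so that the
  arithmetic-geometric mean inequality is an equality in both quadratic forms simultaneously gives
  the displayed inequality (lemma \<open>critical_inequality_if_convex\<close>), and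
  \<open>sos_convex_if_critical_inequality\<close> writes down the factor \<open>L\<close>.
\<close>

section \<open>Necessary conditions for convexity\<close>

text \<open>The derivative of a convex function is monotone, because the graph lies above the tangents
  at any two points; a negative second derivative would make it decrease strictly.\<close>
lemma second_deriv_nonneg_if_convex_on:
  fixes g g1 :: "real \<Rightarrow> real"
  assumes conv: "convex_on UNIV g"
    and g1: "\<And>t. (g has_real_derivative g1 t) (at t)"
    and g2: "(g1 has_real_derivative g2) (at t)"
  shows "g2 \<ge> 0"
proof (rule ccontr)
  assume "\<not> g2 \<ge> 0"
  then obtain d where d: "d > 0" "\<And>h. 0 < h \<Longrightarrow> h < d \<Longrightarrow> g1 (t + h) < g1 t"
    using DERIV_neg_dec_right[OF g2] by auto
  define h where "h = d / 2"
  have h: "h > 0" "g1 (t + h) < g1 t" using d by (auto simp: h_def)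
  have tangent: "g y - g x \<ge> g1 x * (y - x)" for x y
    using convex_on_imp_above_tangent[OF conv, of x y "g1 x"] g1[of x] by auto
  have "g1 t * h \<le> g1 (t + h) * h"
    using tangent[of t "t + h"] tangent[of "t + h" t] by (simp add: algebra_simps)
  with h show False by simp
qed

lemma convex_on_along_line:
  fixes f :: "'a::real_vector \<Rightarrow> real"
  assumes "convex_on UNIV f"
  shows "convex_on UNIV (\<lambda>t. f (x + t *\<^sub>R d))"
proof (rule convex_onI)
  fix s t r :: real
  assume s: "0 < s" "s < 1"
  have "x + ((1 - s) *\<^sub>R t + s *\<^sub>R r) *\<^sub>R d = (1 - s) *\<^sub>R (x + t *\<^sub>R d) + s *\<^sub>R (x + r *\<^sub>R d)"
    by (simp add: algebra_simps)
  then show "f (x + ((1 - s) *\<^sub>R t + s *\<^sub>R r) *\<^sub>R d)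
      \<le> (1 - s) * f (x + t *\<^sub>R d) + s * f (x + r *\<^sub>R d)"
    using convex_onD[OF assms, of s "x + t *\<^sub>R d" "x + r *\<^sub>R d"] s by simp
qed simp

definition trinomial :: "real \<Rightarrow> real \<Rightarrow> nat \<Rightarrow> nat \<Rightarrow> real \<times> real \<Rightarrow> real" where
  "trinomial A B a b z =
     A * (fst z ^ (2 * a) + snd z ^ (2 * b)) + B * fst z ^ a * snd z ^ b"

text \<open>Directions proportional to the point, componentwise, make each power of a coordinate scale by
  a power of \<open>1 + t k\<close> or \<open>1 + t l\<close>. The result is a quadratic form in \<open>(k, l)\<close> in which the
  exponents survive only in the coefficients, while \<open>u\<close> and \<open>v\<close> range freely over the
  positive reals.\<close>
lemma second_deriv_along_scaling_line:
  fixes A B u v k l :: real and a b :: nat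
  assumes "convex_on UNIV (trinomial A B a b)"
    and ab: "a \<ge> 2" "b \<ge> 2" and "u > 0" "v > 0"
  shows "2 * A * (u\<^sup>2 * (real a * (2 * real a - 1)) * k\<^sup>2 + v\<^sup>2 * (real b * (2 * real b - 1)) * l\<^sup>2)
       + B * u * v * (real a * (real a - 1) * k\<^sup>2 + 2 * real a * real b * k * l + real b * (real b - 1) * l\<^sup>2) \<ge> 0"
proof -
  define x where "x = root a u"
  define y where "y = root b v"
  have xu: "x ^ a = u" "y ^ b = v" using assms by (auto simp: x_def y_def)
  then have xu2: "x ^ (2 * a) = u\<^sup>2" "y ^ (2 * b) = v\<^sup>2"
    by (simp_all add: power_even_eq)
  define g where "g = (\<lambda>t. A * (u\<^sup>2 * (1 + t * k) ^ (2 * a) + v\<^sup>2 * (1 + t * l) ^ (2 * b))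
    + B * u * v * ((1 + t * k) ^ a * (1 + t * l) ^ b))"
  define g1 where "g1 = (\<lambda>t. A * (u\<^sup>2 * (2 * a * k * (1 + t * k) ^ (2 * a - 1))
      + v\<^sup>2 * (2 * b * l * (1 + t * l) ^ (2 * b - 1)))
    + B * u * v * (a * k * ((1 + t * k) ^ (a - 1) * (1 + t * l) ^ b)
      + b * l * ((1 + t * k) ^ a * (1 + t * l) ^ (b - 1))))"
  define g2 where "g2 = A * (u\<^sup>2 * (2 * a * k * ((2 * real a - 1) * k))
      + v\<^sup>2 * (2 * b * l * ((2 * real b - 1) * l)))
    + B * u * v * (a * k * ((real a - 1) * k + real b * l) + b * l * (real a * k + (real b - 1) * l))"
  have "trinomial A B a b ((x, y) + t *\<^sub>R (x * k, y * l)) = g t" for t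
  proof -
    have "x + t * (x * k) = x * (1 + t * k)" "y + t * (y * l) = y * (1 + t * l)"
      by (auto simp: algebra_simps)
    then have "trinomial A B a b ((x, y) + t *\<^sub>R (x * k, y * l))
       = A * ((x * (1 + t * k)) ^ (2 * a) + (y * (1 + t * l)) ^ (2 * b))
         + B * (x * (1 + t * k)) ^ a * (y * (1 + t * l)) ^ b"
      by (simp add: trinomial_def)
    also have "\<dots> = g t"
      unfolding g_def power_mult_distrib xu xu2 by simp
    finally show ?thesis .
  qed
  with convex_on_along_line[OF assms(1), of "(x, y)" "(x * k, y * l)"]
  have "convex_on UNIV g" by simp
  moreover have "(g has_real_derivative g1 t) (at t)" for t
    unfolding g_def g1_def by (auto intro!: derivative_eq_intros simp: algebra_simps)
  moreover have "(g1 has_real_derivative g2) (at 0)"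
    unfolding g1_def g2_def using ab
    by (auto intro!: derivative_eq_intros simp: of_nat_diff algebra_simps)
  ultimately have "g2 \<ge> 0" by (rule second_deriv_nonneg_if_convex_on)
  also have "g2 = 2 * A * (u\<^sup>2 * (real a * (2 * real a - 1)) * k\<^sup>2 + v\<^sup>2 * (real b * (2 * real b - 1)) * l\<^sup>2)
       + B * u * v * (real a * (real a - 1) * k\<^sup>2 + 2 * real a * real b * k * l + real b * (real b - 1) * l\<^sup>2)"
    by (simp add: g2_def power2_eq_square algebra_simps)
  finally show ?thesis .
qed

text \<open>In the direction of the first coordinate the second derivative is affine in \<open>v\<close> with slope
  a positive multiple of \<open>B\<close>, so it could not stay nonnegative for large \<open>v\<close> if \<open>B\<close> were
  negative.\<close>
lemma coeff_nonneg_if_convex: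
  assumes "convex_on UNIV (trinomial A B a b)" and ab: "a \<ge> 2" "b \<ge> 2"
  shows "B \<ge> 0"
proof (rule ccontr)
  assume "\<not> B \<ge> 0"
  then have B: "B < 0" by simp
  define C where "C = 2 * A * (real a * (2 * real a - 1))"
  define D where "D = real a * (real a - 1)"
  have D: "D > 0" using ab by (simp add: D_def)
  \<comment> \<open>Large enough that the slope term outweighs \<open>C\<close>.\<close>
  define v where "v = (\<bar>C\<bar> + 1) / (- B * D)"
  have BD: "- B * D > 0" using B D by (simp add: mult_less_0_iff)
  have v: "v > 0" "B * D * v = - (\<bar>C\<bar> + 1)" using BD B D by (auto simp: v_def field_simps)
  have "C + B * v * D \<ge> 0"
    using second_deriv_along_scaling_line[OF assms, of 1 v 1 0] v
    by (simp add: C_def D_def mult_ac)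
  with v show False by (simp add: mult_ac)
qed

text \<open>The second derivative has two pairs of diagonal terms: those with \<open>A\<close>, of sizes
  \<open>u\<^sup>2 a (2a-1) k\<^sup>2\<close> and \<open>v\<^sup>2 b (2b-1) l\<^sup>2\<close>, and those with \<open>B\<close>, of sizes
  \<open>u v a (a-1) k\<^sup>2\<close> and \<open>u v b (b-1) l\<^sup>2\<close>. It is most restrictive where the two terms of each pair agree
  and the mixed term is negative: the ratio of \<open>k\<close> to \<open>l\<close> balances the second pair, and then
  the ratio of \<open>u\<close> to \<open>v\<close> balances the first.\<close>
lemma critical_inequality_if_convex:
  assumes "convex_on UNIV (trinomial A B a b)" and ab: "a \<ge> 2" "b \<ge> 2"
  shows "B * sqrt (real a * real b)
    \<le> 2 * A * sqrt ((2 * real a - 1) * (2 * real b - 1)) + B * sqrt ((real a - 1) * (real b - 1))"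
proof -
  define \<alpha> where "\<alpha> = sqrt a"
  define \<beta> where "\<beta> = sqrt b"
  define P where "P = sqrt (2 * real a - 1)"
  define Q where "Q = sqrt (2 * real b - 1)"
  define M where "M = sqrt (real a - 1)"
  define N where "N = sqrt (real b - 1)"
  have pos: "\<alpha> > 0" "\<beta> > 0" "P > 0" "Q > 0" "M > 0" "N > 0"
    using ab by (auto simp: \<alpha>_def \<beta>_def P_def Q_def M_def N_def)
  have sq: "real a = \<alpha>\<^sup>2" "real b = \<beta>\<^sup>2" "2 * real a - 1 = P\<^sup>2" "2 * real b - 1 = Q\<^sup>2"
      "real a - 1 = M\<^sup>2" "real b - 1 = N\<^sup>2"
    using ab by (auto simp: \<alpha>_def \<beta>_def P_def Q_def M_def N_def)
  \<comment> \<open>The balancing choice is \<open>u = Q M\<close>, \<open>v = P N\<close>, \<open>k = \<beta> N\<close>, \<open>l = - \<alpha> M\<close>.\<close>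
  have "0 \<le> 2 * A * ((Q * M)\<^sup>2 * (\<alpha>\<^sup>2 * P\<^sup>2) * (\<beta> * N)\<^sup>2 + (P * N)\<^sup>2 * (\<beta>\<^sup>2 * Q\<^sup>2) * (- (\<alpha> * M))\<^sup>2)
     + B * (Q * M) * (P * N) * (\<alpha>\<^sup>2 * M\<^sup>2 * (\<beta> * N)\<^sup>2 + 2 * \<alpha>\<^sup>2 * \<beta>\<^sup>2 * (\<beta> * N) * (- (\<alpha> * M))
        + \<beta>\<^sup>2 * N\<^sup>2 * (- (\<alpha> * M))\<^sup>2)"
    using second_deriv_along_scaling_line[OF assms, of "Q * M" "P * N" "\<beta> * N" "- (\<alpha> * M)"] pos
    by (simp only: sq(3-6)) (simp only: sq(1,2) mult_pos_pos)
  also have "\<dots> = (2 * P * Q * M\<^sup>2 * N\<^sup>2 * \<alpha>\<^sup>2 * \<beta>\<^sup>2) * (2 * A * (P * Q) + B * (M * N) - B * (\<alpha> * \<beta>))"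
    by (simp add: power2_eq_square algebra_simps)
  finally have "0 \<le> (2 * P * Q * M\<^sup>2 * N\<^sup>2 * \<alpha>\<^sup>2 * \<beta>\<^sup>2)
      * (2 * A * (P * Q) + B * (M * N) - B * (\<alpha> * \<beta>))" .
  moreover have "2 * P * Q * M\<^sup>2 * N\<^sup>2 * \<alpha>\<^sup>2 * \<beta>\<^sup>2 > 0"
    using pos by simp
  ultimately have "0 \<le> 2 * A * (P * Q) + B * (M * N) - B * (\<alpha> * \<beta>)"
    by (simp only: zero_le_mult_iff) linarith
  then show ?thesis
    by (simp add: \<alpha>_def \<beta>_def P_def Q_def M_def N_def real_sqrt_mult)
qed

section \<open>Bivariate monomials and their partial derivatives\<close>

definition bimonom :: "real \<Rightarrow> nat \<Rightarrow> nat \<Rightarrow> bipoly" where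
  "bimonom r i j = monom (monom r i) j"

lemma bimonom_mult: "bimonom r i j * bimonom s k l = bimonom (r * s) (i + k) (j + l)"
  by (simp add: bimonom_def mult_monom)

lemma bimonom_add: "bimonom r i j + bimonom s i j = bimonom (r + s) i j"
  by (simp add: bimonom_def add_monom)

lemma bimonom_zero: "bimonom 0 i j = 0"
  by (simp add: bimonom_def)

lemma bimonom_eq: "bimonom r i j = Const r * X1 ^ i * X2 ^ j"
proof -
  have C: "Const r = bimonom r 0 0" by (simp add: Const_def bimonom_def monom_0)
  have X1: "X1 = bimonom 1 1 0" by (simp add: X1_def bimonom_def monom_0 monom_Suc)
  have X2: "X2 = bimonom 1 0 1" by (simp add: X2_def bimonom_def monom_0 monom_Suc one_pCons)
  have "bimonom 1 1 0 ^ i = bimonom 1 i 0" "bimonom 1 0 1 ^ j = bimonom 1 0 j"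
    by (simp_all add: bimonom_def monom_power)
  then show ?thesis by (simp add: C X1 X2 bimonom_mult)
qed

lemma partial_add: "partial i (p + q) = partial i p + partial i q"
proof -
  have "map_poly pderiv (p + q) = map_poly pderiv p + map_poly pderiv q"
    by (rule poly_eqI) (simp add: coeff_map_poly pderiv_add)
  then show ?thesis by (simp add: partial_def pderiv_add)
qed

lemma partial_0_bimonom: "partial 0 (bimonom r i j) = bimonom (real i * r) (i - 1) j"
  by (simp add: partial_def bimonom_def map_poly_monom pderiv_monom)

lemma partial_1_bimonom: "partial (Suc 0) (bimonom r i j) = bimonom (real j * r) i (j - 1)"
proof -
  have "(of_nat j :: real poly) = monom (of_nat j) 0"
    by (simp add: monom_0 of_nat_poly)
  then show ?thesis by (simp add: partial_def bimonom_def pderiv_monom mult_monom)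
qed

lemma partial_zero: "partial i 0 = 0"
  by (simp add: partial_def)

lemma eval_bimonom: "eval (bimonom r i j) z = r * fst z ^ i * snd z ^ j"
  by (simp add: eval_def bimonom_def poly_monom poly_power)

lemma eval_add: "eval (p + q) z = eval p z + eval q z"
  by (simp add: eval_def)

section \<open>Sum of squares decomposition of the Hessian\<close>

lemma sos_matrix_three_rows:
  assumes "H \<in> carrier_mat 2 2"
    and "H $$ (0, 0) = e\<^sub>0 * e\<^sub>0 + e\<^sub>1 * e\<^sub>1 + e\<^sub>2 * e\<^sub>2"
    and "H $$ (0, 1) = e\<^sub>0 * f\<^sub>0 + e\<^sub>1 * f\<^sub>1 + e\<^sub>2 * f\<^sub>2"
    and "H $$ (1, 0) = e\<^sub>0 * f\<^sub>0 + e\<^sub>1 * f\<^sub>1 + e\<^sub>2 * f\<^sub>2"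
    and "H $$ (1, 1) = f\<^sub>0 * f\<^sub>0 + f\<^sub>1 * f\<^sub>1 + f\<^sub>2 * f\<^sub>2"
  shows "sos_matrix H"
proof -
  define L where
    "L = mat 3 2 (\<lambda>(i, j). if j = 0 then [e\<^sub>0, e\<^sub>1, e\<^sub>2] ! i else [f\<^sub>0, f\<^sub>1, f\<^sub>2] ! i)"
  have "H = transpose_mat L * L"
    using assms
    by (intro eq_matI)
       (auto simp: L_def scalar_prod_def less_2_cases_iff numeral_3_eq_3 mult_ac)
  moreover have "L \<in> carrier_mat 3 (dim_col H)"
    using assms by (auto simp: L_def)
  ultimately show ?thesis unfolding sos_matrix_def by blast
qed

text \<open>The Gram matrix of the Hessian splits into two blocks, with diagonals \<open>(p, q)\<close> and
  \<open>(s, t)\<close>. The second block absorbs as much of the mixed coefficient as it can, namely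
  \<open>sqrt (s t)\<close>, and so has rank one and contributes a single square. The remainder
  \<open>r\<close> is nonnegative since \<open>(a-1) (b-1) \<le> a b\<close>, and the assumed inequality says
  that \<open>r \<le> sqrt (p q)\<close>, so that the first block is positive semidefinite and contributes the two
  squares of its Cholesky factorization. Evenness of \<open>a\<close> and \<open>b\<close> makes
  \<open>x^(a-2) y^b\<close> and \<open>x^a y^(b-2)\<close> squares of monomials.\<close>
lemma sos_convex_if_critical_inequality:
  fixes A B :: real and a b :: nat
  assumes A: "A \<ge> 0" and B: "B \<ge> 0" and ab: "a \<ge> 2" "even a" "b \<ge> 2" "even b"
    and ineq: "B * sqrt (real a * real b)
      \<le> 2 * A * sqrt ((2 * real a - 1) * (2 * real b - 1)) + B * sqrt ((real a - 1) * (real b - 1))"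
  shows "sos_convex (bimonom A (2 * a) 0 + bimonom A 0 (2 * b) + bimonom B a b)"
proof -
  obtain m n where mn: "a = 2 * m + 2" "b = 2 * n + 2"
  proof -
    from ab obtain i j where "a = 2 * i" "b = 2 * j" by (auto elim!: evenE)
    with ab that[of "i - 1" "j - 1"] show ?thesis by auto
  qed
  define p where "p = 2 * A * (a * (2 * real a - 1))"
  define q where "q = 2 * A * (b * (2 * real b - 1))"
  define s where "s = B * (a * (real a - 1))"
  define t where "t = B * (b * (real b - 1))"
  have nonneg: "p \<ge> 0" "q \<ge> 0" "s \<ge> 0" "t \<ge> 0"
    using A B ab by (auto simp: p_def q_def s_def t_def)
  define r where "r = B * a * b - sqrt s * sqrt t"
  have st: "sqrt s * sqrt t = B * sqrt (real a * real b) * sqrt ((real a - 1) * (real b - 1))"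
    using B by (simp add: s_def t_def real_sqrt_mult mult_ac)
  have pq: "sqrt p * sqrt q = 2 * A * sqrt ((2 * real a - 1) * (2 * real b - 1)) * sqrt (real a * real b)"
  proof -
    have "p * q = (2 * A)\<^sup>2 * ((2 * real a - 1) * (2 * real b - 1)) * (real a * real b)"
      by (simp add: p_def q_def power2_eq_square)
    then have "sqrt p * sqrt q
        = sqrt ((2 * A)\<^sup>2) * sqrt ((2 * real a - 1) * (2 * real b - 1)) * sqrt (real a * real b)"
      by (simp only: real_sqrt_mult[symmetric])
    also have "sqrt ((2 * A)\<^sup>2) = 2 * A" using A by (simp only: real_sqrt_abs)
    finally show ?thesis .
  qed
  have rr: "r = sqrt (real a * real b) * (B * sqrt (real a * real b) - B * sqrt ((real a - 1) * (real b - 1)))"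
    by (simp add: r_def st algebra_simps)
  have "(real a - 1) * (real b - 1) \<le> real a * real b" using ab by (intro mult_mono) auto
  then have r0: "r \<ge> 0"
    unfolding rr using B ab by (simp add: mult_left_mono)
  have rle: "r \<le> sqrt p * sqrt q"
    unfolding rr pq using mult_left_mono[OF ineq, of "sqrt (real a * real b)"] by (simp add: algebra_simps)
  \<comment> \<open>A correlation coefficient of the first block; introducing it as a factor instead of
    dividing by \<open>sqrt p\<close> covers the case \<open>A = 0\<close>, where the block vanishes.\<close>
  obtain \<theta> where \<theta>: "0 \<le> \<theta>" "\<theta> \<le> 1" "r = \<theta> * (sqrt p * sqrt q)"
  proof (cases "sqrt p * sqrt q = 0")
    case True
    then show ?thesis using that[of 0] r0 rle by (auto simp del: mult_eq_0_iff)
  next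
    case False
    then show ?thesis using that[of "r / (sqrt p * sqrt q)"] r0 rle nonneg
      by (simp add: divide_le_eq_1)
  qed
  have \<theta>2: "sqrt (1 - \<theta>\<^sup>2) * sqrt (1 - \<theta>\<^sup>2) = 1 - \<theta> * \<theta>"
    using \<theta> by (simp add: power2_eq_square mult_le_one)
  \<comment> \<open>The columns of \<open>L\<close>: rows 0 and 1 factor the first block, row 2 the second. The
    entry \<open>e\<^sub>1\<close> is zero.\<close>
  define e\<^sub>0 where "e\<^sub>0 = bimonom (sqrt p) (a - 1) 0"
  define f\<^sub>0 where "f\<^sub>0 = bimonom (\<theta> * sqrt q) 0 (b - 1)"
  define f\<^sub>1 where "f\<^sub>1 = bimonom (sqrt (1 - \<theta>\<^sup>2) * sqrt q) 0 (b - 1)"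
  define e\<^sub>2 where "e\<^sub>2 = bimonom (sqrt s) m (n + 1)"
  define f\<^sub>2 where "f\<^sub>2 = bimonom (sqrt t) (m + 1) n"
  let ?p = "bimonom A (2 * a) 0 + bimonom A 0 (2 * b) + bimonom B a b"
  have "sos_matrix (hessian ?p)"
  proof (rule sos_matrix_three_rows[where e\<^sub>0 = e\<^sub>0 and e\<^sub>1 = 0 and e\<^sub>2 = e\<^sub>2
        and f\<^sub>0 = f\<^sub>0 and f\<^sub>1 = f\<^sub>1 and f\<^sub>2 = f\<^sub>2])
    show "hessian ?p \<in> carrier_mat 2 2" by (simp add: hessian_def)
    have "e\<^sub>0 * e\<^sub>0 = bimonom p (2 * a - 2) 0" "e\<^sub>2 * e\<^sub>2 = bimonom s (a - 2) b"
      using mn by (simp_all add: e\<^sub>0_def e\<^sub>2_def bimonom_mult nonneg mult_2)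
    moreover have "partial 0 (partial 0 ?p) = bimonom p (2 * a - 2) 0 + bimonom s (a - 2) b"
      using mn
      by (simp add: partial_add partial_0_bimonom partial_zero bimonom_zero p_def s_def of_nat_diff
          algebra_simps)
    ultimately show "hessian ?p $$ (0, 0) = e\<^sub>0 * e\<^sub>0 + 0 * 0 + e\<^sub>2 * e\<^sub>2"
      by (simp add: hessian_def)
    have cross: "partial 0 (partial (Suc 0) ?p) = bimonom (B * a * b) (a - 1) (b - 1)"
      "partial (Suc 0) (partial 0 ?p) = bimonom (B * a * b) (a - 1) (b - 1)"
      by (simp_all add: partial_add partial_0_bimonom partial_1_bimonom partial_zero bimonom_zero mult_ac)
    have "e\<^sub>0 * f\<^sub>0 + 0 * f\<^sub>1 + e\<^sub>2 * f\<^sub>2 = bimonom r (a - 1) (b - 1) + bimonom (sqrt s * sqrt t) (a - 1) (b - 1)"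
      using mn by (simp add: e\<^sub>0_def f\<^sub>0_def e\<^sub>2_def f\<^sub>2_def bimonom_mult \<theta>(3) mult_ac mult_2_right add_ac)
    also have "\<dots> = bimonom (B * a * b) (a - 1) (b - 1)"
      by (simp add: bimonom_add r_def)
    finally have off: "e\<^sub>0 * f\<^sub>0 + 0 * f\<^sub>1 + e\<^sub>2 * f\<^sub>2 = bimonom (B * a * b) (a - 1) (b - 1)" .
    show "hessian ?p $$ (0, 1) = e\<^sub>0 * f\<^sub>0 + 0 * f\<^sub>1 + e\<^sub>2 * f\<^sub>2"
      unfolding off by (simp add: hessian_def cross)
    show "hessian ?p $$ (1, 0) = e\<^sub>0 * f\<^sub>0 + 0 * f\<^sub>1 + e\<^sub>2 * f\<^sub>2"
      unfolding off by (simp add: hessian_def cross)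
    have "\<theta> * sqrt q * (\<theta> * sqrt q) + sqrt (1 - \<theta>\<^sup>2) * sqrt q * (sqrt (1 - \<theta>\<^sup>2) * sqrt q)
        = (\<theta> * \<theta> + sqrt (1 - \<theta>\<^sup>2) * sqrt (1 - \<theta>\<^sup>2)) * (sqrt q * sqrt q)"
      by (simp only: distrib_left distrib_right mult_ac)
    also have "\<dots> = q"
      unfolding \<theta>2 using nonneg by simp
    finally have "f\<^sub>0 * f\<^sub>0 + f\<^sub>1 * f\<^sub>1 = bimonom q (0 + 0) (b - 1 + (b - 1))"
      by (simp only: f\<^sub>0_def f\<^sub>1_def bimonom_mult bimonom_add)
    then have "f\<^sub>0 * f\<^sub>0 + f\<^sub>1 * f\<^sub>1 = bimonom q 0 (2 * b - 2)"
      using mn by simp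
    moreover have "f\<^sub>2 * f\<^sub>2 = bimonom t a (b - 2)"
      using mn by (simp add: f\<^sub>2_def bimonom_mult nonneg mult_2)
    moreover have "partial (Suc 0) (partial (Suc 0) ?p) = bimonom q 0 (2 * b - 2) + bimonom t a (b - 2)"
      using mn
      by (simp add: partial_add partial_1_bimonom partial_zero bimonom_zero q_def t_def of_nat_diff algebra_simps)
    ultimately show "hessian ?p $$ (1, 1) = f\<^sub>0 * f\<^sub>0 + f\<^sub>1 * f\<^sub>1 + f\<^sub>2 * f\<^sub>2"
      by (simp add: hessian_def)
  qed
  then show ?thesis by (simp add: sos_convex_def)
qed

theorem theorem3p2:
  fixes l1 l2 c :: real and a1 a2 :: nat and p :: bipoly
  assumes "l1 \<ge> 0" and "l2 \<ge> 0"
    and "a1 \<ge> 2" and "even a1" and "a2 \<ge> 2" and "even a2"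
    and p: "p = Const (l1 * l2) * (X1 ^ (2 * a1) + X2 ^ (2 * a2))
              + Const (l1\<^sup>2 + l2\<^sup>2 - c) * X1 ^ a1 * X2 ^ a2"
    and "convex_on UNIV (eval p)"
  shows "sos_convex p"
proof -
  define A where "A = l1 * l2"
  define B where "B = l1\<^sup>2 + l2\<^sup>2 - c"
  have p_eq: "p = bimonom A (2 * a1) 0 + bimonom A 0 (2 * a2) + bimonom B a1 a2"
    by (simp add: p bimonom_eq A_def B_def distrib_left)
  have "eval p = trinomial A B a1 a2"
    by (rule ext) (simp add: p_eq eval_add eval_bimonom trinomial_def distrib_left)
  with assms have conv: "convex_on UNIV (trinomial A B a1 a2)" by simp
  have "A \<ge> 0" using assms by (simp add: A_def)
  then show ?thesis
    unfolding p_eq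
    using assms coeff_nonneg_if_convex[OF conv] critical_inequality_if_convex[OF conv]
    by (intro sos_convex_if_critical_inequality) auto
qed

end
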